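(* Let $(K_1,\ldots,K_n)$ be a Cantor-type graph-directed attractor in $\mathbb{R}^d$, and let $Q_{i,k}$ denote the level-$k$ approximation of $K_i$. Put $$c(n,d):=(d-1)n^2+\frac{n^2+n}{2}+d-1.$$ Let $i,j\in\{1,\ldots,n\}$ be distinct. Then $K_i\cap K_j\neq\varnothing$ if and only if $Q_{i,c(n,d)}\cap Q_{j,c(n,d)}\neq\varnothing$.
   Context: Setting. Let $d\ge 1$, $n\ge 1$ and $N\geq 2$ be integers. Let $G$ be a finite directed graph (loops and multiple edges allowed) with vertex set $\{1,\ldots,n\}$ and edge set $\mathcal{E}$, such that every vertex has at least one outgoing edge; $\mathcal{E}_{i,j}$ denotes the set of edges from $i$ to $j$. To each $e\in\mathcal{E}$ is assigned a map $\varphi_e:\mathbb{R}^d\to\mathbb{R}^d$, $\varphi_e(x)=N^{-1}(x+t_e)$ with $t_e\in\{0,1,\ldots,N-1\}^d$ (the same $N$ for all edges). It is assumed that $\varphi_e\neq\varphi_{e'}$ for distinct $e,e'$ in the same $\mathcal{E}_{i,j}$. The associated Cantor-type graph-directed attractor is the unique $n$-tuple $(K_1,\ldots,K_n)$ of non-empty compact sets in $\mathbb{R}^d$ with $K_i=\bigcup_{j=1}^n\bigcup_{e\in\mathcal{E}_{i,j}}\varphi_e(K_j)$ for all $i$. Level-$k$ approximations: $Q_{i,0}:=[0,1]^d$ and $Q_{i,k}:=\bigcup_{j=1}^n\bigcup_{e\in\mathcal{E}_{i,j}}\varphi_e(Q_{j,k-1})$ for $k\ge1$, $1\le i\le n$.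 *)

theory Defs
  imports "HOL-Analysis.Analysis" "Graph_Theory.Digraph"
begin

definition edges_betw :: "('v, 'e) pre_digraph \<Rightarrow> 'v \<Rightarrow> 'v \<Rightarrow> 'e set" where
  "edges_betw G i j = {e \<in> arcs G. tail G e = i \<and> head G e = j}"

definition contr :: "nat \<Rightarrow> ('e \<Rightarrow> real ^ 'd) \<Rightarrow> 'e \<Rightarrow> real ^ 'd \<Rightarrow> real ^ 'd" where
  "contr N t e x = (1 / real N) *\<^sub>R (x + t e)"

text \<open>The dimension \<open>d\<close> is \<open>CARD('d)\<close>. Loops and parallel edges are allowed in \<^locale>\<open>fin_digraph\<close>.\<close>

locale cantor_graph_system = fin_digraph G
  for G :: "(nat, 'e) pre_digraph" and n N :: nat and t :: "'e \<Rightarrow> real ^ 'd" +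
  assumes n_ge_1: "n \<ge> 1"
    and N_ge_2: "N \<ge> 2"
    and verts_eq: "verts G = {1..n}"
    and out_arcs_nonempty: "i \<in> verts G \<Longrightarrow> out_arcs G i \<noteq> {}"
    and digits: "e \<in> arcs G \<Longrightarrow> t e $ k \<in> real ` {0..N - 1}"
    and contr_distinct:
      "\<lbrakk>i \<in> verts G; j \<in> verts G; e \<in> edges_betw G i j; e' \<in> edges_betw G i j; e \<noteq> e'\<rbrakk>
        \<Longrightarrow> contr N t e \<noteq> contr N t e'"

text \<open>For a \<^const>\<open>cantor_graph_system\<close> the following conditions determine the tuple
  \<open>(K i)\<close>, \<open>i \<in> verts G\<close>, uniquely; values of \<open>K\<close> outside \<^term>\<open>verts G\<close> are irrelevant.\<close>

definition is_attractor ::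
    "(nat, 'e) pre_digraph \<Rightarrow> nat \<Rightarrow> ('e \<Rightarrow> real ^ 'd) \<Rightarrow> (nat \<Rightarrow> (real ^ 'd) set) \<Rightarrow> bool" where
  "is_attractor G N t K \<longleftrightarrow>
    (\<forall>i \<in> verts G. K i \<noteq> {} \<and> compact (K i) \<and>
      K i = (\<Union>j \<in> verts G. \<Union>e \<in> edges_betw G i j. contr N t e ` K j))"

primrec level_approx ::
    "(nat, 'e) pre_digraph \<Rightarrow> nat \<Rightarrow> ('e \<Rightarrow> real ^ 'd) \<Rightarrow> nat \<Rightarrow> nat \<Rightarrow> (real ^ 'd) set" where
  "level_approx G N t 0 i = {x. \<forall>k. 0 \<le> x $ k \<and> x $ k \<le> 1}"
| "level_approx G N t (Suc m) i =
    (\<Union>j \<in> verts G. \<Union>e \<in> edges_betw G i j. contr N t e ` level_approx G N t m j)"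

text \<open>For \<open>d \<ge> 1\<close> the natural-number subtraction does not truncate, and the division is exact.\<close>

definition c_bound :: "nat \<Rightarrow> nat \<Rightarrow> nat" where
  "c_bound n d = (d - 1) * n\<^sup>2 + (n\<^sup>2 + n) div 2 + (d - 1)"

end

theory Submission
  imports Defs
begin

text \<open>
  Follow two level-\<open>m\<close> cubes descending from \<open>i\<close> and \<open>j\<close> and record the terminal vertices \<open>p\<close>, \<open>q\<close>
  of the two paths together with the relative offset \<open>\<delta>\<close> of the cubes in units of their side
  length. The cubes meet iff \<open>\<delta> \<in> {-1, 0, 1}\<^sup>d\<close>, and the offset evolves by
  \<open>\<delta>' = N \<delta> + t\<^sub>e - t\<^sub>f\<close>. Once a coordinate of \<open>\<delta>\<close> is nonzero it can never change again, so a
  walk passes through at most \<open>d + 1\<close> phases, according to the size of the support of \<open>\<delta>\<close>, and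
  \<open>\<delta>\<close> is constant on each of them. A repeated state produces a cycle, hence a common point of the
  attractors. If there is none, a phase visits each pair \<open>(p, q)\<close> at most once;
  for \<open>\<delta> = 0\<close> the pairs are moreover off-diagonal and may be counted unordered, and for full
  support the two digits are forced individually, so that both walks can be closed up
  independently and the phase has at most \<open>n\<close> steps. This bounds the number of states by
  \<open>n (n - 1) / 2 + (d - 1) n\<^sup>2 + n\<close>, which is at most \<open>c(n, d)\<close>.
\<close>

text \<open>Removes error terms of the form constant over \<open>N ^ m\<close>, both when the
  attractor is placed in the unit cube and when distances between attractors are shown to
  vanish.\<close>

lemma nonpos_if_le_geometric:
  fixes b C r :: real
  assumes "\<And>m. b \<le> C / r ^ m" "r > 1"
  shows "b \<le> 0"
proof -
  have "(\<lambda>m. C * inverse r ^ m) \<longlonglongrightarrow> C * 0"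
    by (intro tendsto_mult tendsto_const LIMSEQ_realpow_zero) (use assms(2) in \<open>auto simp: field_simps\<close>)
  then have "(\<lambda>m. C / r ^ m) \<longlonglongrightarrow> 0"
    by (simp add: field_simps)
  then show ?thesis
    using assms(1) by (intro LIMSEQ_le_const) auto
qed

section \<open>The attractor and its level approximations\<close>

locale attractor_system = cantor_graph_system G n N t
  for G :: "(nat, 'e) pre_digraph" and n N :: nat and t :: "'e \<Rightarrow> real ^ 'd" +
  fixes K :: "nat \<Rightarrow> (real ^ 'd) set"
  assumes attractor: "is_attractor G N t K"
begin

lemma N_gt_1: "real N > 1"
  using N_ge_2 by simp

lemma digit_bounds:
  assumes "e \<in> arcs G"
  shows "0 \<le> t e $ c" "t e $ c \<le> real N - 1"
  using digits[OF assms, of c] N_ge_2 by (auto simp: of_nat_diff[symmetric] simp del: of_nat_diff)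

lemma digit_Ints: "e \<in> arcs G \<Longrightarrow> t e $ c \<in> \<int>"
  using digits[of e c] by auto

lemma edges_betw_verts: "e \<in> edges_betw G p p' \<Longrightarrow> e \<in> arcs G \<and> p \<in> verts G \<and> p' \<in> verts G"
  unfolding edges_betw_def by auto

lemma K_nonempty: "p \<in> verts G \<Longrightarrow> K p \<noteq> {}"
  and K_compact: "p \<in> verts G \<Longrightarrow> compact (K p)"
  and K_unfold: "p \<in> verts G \<Longrightarrow> K p = (\<Union>q \<in> verts G. \<Union>e \<in> edges_betw G p q. contr N t e ` K q)"
  using attractor unfolding is_attractor_def by blast+

lemma contr_in_K:
  assumes "e \<in> edges_betw G p p'" "x \<in> K p'"
  shows "contr N t e x \<in> K p"
  using K_unfold[of p] edges_betw_verts[OF assms(1)] assms by blast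

lemma K_bounded:
  obtains C where "\<And>p x. p \<in> verts G \<Longrightarrow> x \<in> K p \<Longrightarrow> norm x \<le> C"
proof -
  have "bounded (\<Union>p \<in> verts G. K p)"
    by (intro bounded_UN) (auto intro: K_compact compact_imp_bounded)
  then show ?thesis
    using that unfolding bounded_iff by blast
qed

lemma contr_nth: "contr N t e x $ c = (x $ c + t e $ c) / real N"
  by (simp add: contr_def)

text \<open>Digits between 0 and \<open>N - 1\<close> preserve the unit cube, so each unfolding of
  \<open>K\<close> divides the bound on the excess of a coordinate beyond 0 or 1 by
  \<open>N\<close>. Boundedness of the attractor starts the induction, and the limit leaves no
  excess.\<close>

lemma K_subset_unit_cube:
  assumes "p \<in> verts G" "x \<in> K p"
  shows "0 \<le> x $ c" "x $ c \<le> 1"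
proof -
  obtain C where C: "\<And>p x. p \<in> verts G \<Longrightarrow> x \<in> K p \<Longrightarrow> norm x \<le> C"
    using K_bounded by blast
  have bd: "- x $ c \<le> (C + 1) / real N ^ m \<and> x $ c - 1 \<le> (C + 1) / real N ^ m" for m
    using assms
  proof (induction m arbitrary: p x)
    case 0
    then have "\<bar>x $ c\<bar> \<le> C"
      using C component_le_norm_cart[of x c] order_trans by blast
    then show ?case by auto
  next
    case (Suc m)
    obtain q e y where y: "q \<in> verts G" "e \<in> edges_betw G p q" "y \<in> K q" "x = contr N t e y"
      using Suc.prems K_unfold[of p] by auto
    have e: "e \<in> arcs G" using edges_betw_verts y(2) by blast
    have IH: "- y $ c \<le> (C + 1) / real N ^ m" "y $ c - 1 \<le> (C + 1) / real N ^ m"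
      using Suc.IH[OF y(1,3)] by auto
    have "- x $ c \<le> - y $ c / real N"
      using digit_bounds(1)[OF e, of c] N_gt_1 by (simp add: y(4) contr_nth divide_simps)
    also have "\<dots> \<le> (C + 1) / real N ^ m / real N"
      using IH(1) N_gt_1 by (intro divide_right_mono) auto
    finally have 1: "- x $ c \<le> (C + 1) / real N ^ Suc m" by (simp add: mult.commute)
    have "x $ c - 1 \<le> (y $ c - 1) / real N"
      using digit_bounds(2)[OF e, of c] N_gt_1 by (simp add: y(4) contr_nth divide_simps)
    also have "\<dots> \<le> (C + 1) / real N ^ m / real N"
      using IH(2) N_gt_1 by (intro divide_right_mono) auto
    finally have 2: "x $ c - 1 \<le> (C + 1) / real N ^ Suc m" by (simp add: mult.commute)
    show ?case using 1 2 by blast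
  qed
  show "0 \<le> x $ c"
    using nonpos_if_le_geometric[of "- x $ c" "C + 1" "real N"] bd N_gt_1 by auto
  show "x $ c \<le> 1"
    using nonpos_if_le_geometric[of "x $ c - 1" "C + 1" "real N"] bd N_gt_1 by auto
qed

lemma K_subset_level_approx: "p \<in> verts G \<Longrightarrow> K p \<subseteq> level_approx G N t m p"
proof (induction m arbitrary: p)
  case 0
  then show ?case using K_subset_unit_cube by auto
next
  case (Suc m)
  show ?case
    unfolding K_unfold[OF Suc.prems] level_approx.simps
    by (intro UN_mono image_mono Suc.IH order_refl)
qed

lemma level_approx_unit_cube:
  "x \<in> level_approx G N t m p \<Longrightarrow> 0 \<le> x $ c \<and> x $ c \<le> 1"
proof (induction m arbitrary: p x)
  case (Suc m)
  obtain q e y where y: "e \<in> edges_betw G p q" "y \<in> level_approx G N t m q" "x = contr N t e y"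
    using Suc.prems by auto
  have "e \<in> arcs G" using edges_betw_verts y(1) by blast
  then show ?case
    using Suc.IH[OF y(2)] digit_bounds[of e c] N_gt_1 by (simp add: y(3) contr_nth field_simps)
qed auto

section \<open>Walks of relative offsets\<close>

definition step :: "nat \<times> nat \<times> (real ^ 'd) \<Rightarrow> nat \<times> nat \<times> (real ^ 'd) \<Rightarrow> bool" where
  "step = (\<lambda>(p, q, D) (p', q', D'). \<exists>e \<in> edges_betw G p p'. \<exists>f \<in> edges_betw G q q'.
     D' = real N *\<^sub>R D + t e - t f)"

text \<open>The sign convention makes \<open>D\<close> the position of the first copy relative to
  the second, in units of their common side length.\<close>

definition meets :: "nat \<times> nat \<times> (real ^ 'd) \<Rightarrow> bool" where
  "meets = (\<lambda>(p, q, D). \<exists>x \<in> K p. x + D \<in> K q)"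

lemma step_verts: "step (p, q, D) s \<Longrightarrow> p \<in> verts G \<and> q \<in> verts G"
  unfolding step_def using edges_betw_verts by (cases s) auto

lemma contr_diff:
  assumes "D' = real N *\<^sub>R D + t e - t f"
  shows "contr N t e x + D - contr N t f y = (1 / real N) *\<^sub>R (x + D' - y)"
  using N_gt_1 by (simp add: contr_def assms algebra_simps)

text \<open>A common point of two subcopies is also common to the copies containing them. Read
  contrapositively, failure to meet propagates forward along a walk.\<close>

lemma meets_step:
  assumes "step s s'" "meets s'"
  shows "meets s"
proof -
  obtain p q D p' q' D' where s: "s = (p, q, D)" "s' = (p', q', D')"
    by (metis prod_cases3)
  obtain e f where ef: "e \<in> edges_betw G p p'" "f \<in> edges_betw G q q'"
      "D' = real N *\<^sub>R D + t e - t f"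
    using assms(1) unfolding s step_def by auto
  obtain x where x: "x \<in> K p'" "x + D' \<in> K q'"
    using assms(2) unfolding s meets_def by auto
  have "contr N t e x + D = contr N t f (x + D')"
    using contr_diff[OF ef(3), of x "x + D'"] by simp
  then show ?thesis
    using contr_in_K[OF ef(1) x(1)] contr_in_K[OF ef(2) x(2)] unfolding s meets_def prod.case
    by (intro bexI[of _ "contr N t e x"]) simp_all
qed

text \<open>Walking \<open>m\<close> steps inside \<open>S\<close> and pulling back arbitrary end
  points gives points at distance at most a constant over \<open>N ^ m\<close>; compactness turns
  distance 0 into a common point. This is how cycles of states produce intersections.\<close>

lemma meets_coinduct:
  assumes "finite S" and succ: "\<And>s. s \<in> S \<Longrightarrow> \<exists>s' \<in> S. step s s'" and "s \<in> S"
  shows "meets s"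
proof -
  obtain C where C: "\<And>p x. p \<in> verts G \<Longrightarrow> x \<in> K p \<Longrightarrow> norm x \<le> C"
    using K_bounded by blast
  have "bounded ((snd \<circ> snd) ` S)"
    using assms(1) by (intro finite_imp_bounded finite_imageI)
  then obtain B where B: "\<And>p q D. (p, q, D) \<in> S \<Longrightarrow> norm D \<le> B"
    unfolding bounded_iff by force
  have approx: "\<exists>x \<in> K p. \<exists>y \<in> K q. norm (x + D - y) \<le> (2 * C + B) / real N ^ m"
    if "(p, q, D) \<in> S" for p q D m
    using that
  proof (induction m arbitrary: p q D)
    case 0
    have v: "p \<in> verts G" "q \<in> verts G"
      using succ[OF 0] step_verts by blast+
    obtain x y where xy: "x \<in> K p" "y \<in> K q"
      using K_nonempty v by blast
    have "norm (x + D - y) \<le> norm x + norm D + norm y"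
      by (meson add_mono norm_triangle_ineq norm_triangle_ineq4 order_refl order_trans)
    also have "\<dots> \<le> (2 * C + B) / real N ^ 0"
      using C[OF v(1) xy(1)] C[OF v(2) xy(2)] B[OF 0] by simp
    finally show ?case using xy by blast
  next
    case (Suc m)
    obtain p' q' D' where s': "(p', q', D') \<in> S" "step (p, q, D) (p', q', D')"
      using succ[OF Suc.prems] by auto
    then obtain e f where ef: "e \<in> edges_betw G p p'" "f \<in> edges_betw G q q'"
        "D' = real N *\<^sub>R D + t e - t f"
      unfolding step_def by auto
    obtain x y where xy: "x \<in> K p'" "y \<in> K q'" "norm (x + D' - y) \<le> (2 * C + B) / real N ^ m"
      using Suc.IH[OF s'(1)] by blast
    have "norm (contr N t e x + D - contr N t f y) = norm (x + D' - y) / real N"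
      unfolding contr_diff[OF ef(3)] by simp
    also have "\<dots> \<le> (2 * C + B) / real N ^ m / real N"
      using xy(3) by (intro divide_right_mono) auto
    also have "\<dots> = (2 * C + B) / real N ^ Suc m"
      by (simp add: mult.commute)
    finally show ?case
      using contr_in_K[OF ef(1) xy(1)] contr_in_K[OF ef(2) xy(2)] by blast
  qed
  obtain p q D where s: "s = (p, q, D)" by (metis prod_cases3)
  have v: "p \<in> verts G" "q \<in> verts G"
    using succ[OF assms(3)] step_verts unfolding s by blast+
  let ?A = "(\<lambda>x. x + D) ` K p"
  have "setdist ?A (K q) \<le> (2 * C + B) / real N ^ m" for m
  proof -
    obtain x y where "x \<in> K p" "y \<in> K q" "norm (x + D - y) \<le> (2 * C + B) / real N ^ m"
      using approx assms(3) s by blast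
    then show ?thesis
      using setdist_le_dist[of "x + D" ?A y "K q"] by (auto simp: dist_norm)
  qed
  then have "setdist ?A (K q) = 0"
    using nonpos_if_le_geometric N_gt_1 setdist_pos_le[of ?A "K q"] by (meson order_antisym)
  moreover have "compact ?A"
    by (intro compact_continuous_image K_compact v continuous_intros)
  ultimately have "?A \<inter> K q \<noteq> {}"
    using setdist_eq_0_compact_closed[of ?A "K q"] K_compact K_nonempty v
    by (auto simp: compact_imp_closed)
  then show ?thesis
    unfolding s meets_def by auto
qed

lemma meets_diagonal: "p \<in> verts G \<Longrightarrow> meets (p, p, 0)"
  using K_nonempty unfolding meets_def by auto

lemma step_swap: "step (p, q, D) (p', q', D') \<Longrightarrow> step (q, p, - D) (q', p', - D')"
  unfolding step_def by (force simp: algebra_simps)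

text \<open>Only the inequalities \<open>0 \<le> t\<^sub>e \<le> N - 1\<close> matter: \<open>N + t\<^sub>e - t\<^sub>f \<ge> 1\<close>, with equality
  iff \<open>t\<^sub>e = 0\<close> and \<open>t\<^sub>f = N - 1\<close>.\<close>

lemma step_offset_persistent:
  assumes "step (p, q, D) (p', q', D')" "D $ c \<in> {-1, 0, 1}" "D' $ c \<in> {-1, 0, 1}" "D $ c \<noteq> 0"
  shows "D' $ c = D $ c"
proof -
  obtain e f where ef: "e \<in> edges_betw G p p'" "f \<in> edges_betw G q q'"
      "D' = real N *\<^sub>R D + t e - t f"
    using assms(1) unfolding step_def by auto
  then have "e \<in> arcs G" "f \<in> arcs G"
    using edges_betw_verts by blast+
  then show ?thesis
    using assms(2-4) digit_bounds[of e c] digit_bounds[of f c] unfolding ef(3) by auto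
qed

text \<open>A coordinate equal to 1 satisfies \<open>1 = N + t e $ c - t f $ c\<close>, which forces
  the digits 0 and \<open>N - 1\<close>; for -1 they are interchanged. Hence the digits depend on
  \<open>D\<close> alone, and the first edge of one step can be paired with the second edge of
  another.\<close>

lemma step_exchange:
  assumes "step (p, q, D) (p', q', D)" "step (u, v, D) (u', v', D)" "\<And>c. D $ c \<in> {-1, 1}"
  shows "step (p, v, D) (p', v', D)"
proof -
  obtain e f where ef: "e \<in> edges_betw G p p'" "f \<in> edges_betw G q q'"
      "D = real N *\<^sub>R D + t e - t f"
    using assms(1) unfolding step_def by auto
  obtain e' f' where ef': "e' \<in> edges_betw G u u'" "f' \<in> edges_betw G v v'"
      "D = real N *\<^sub>R D + t e' - t f'"
    using assms(2) unfolding step_def by auto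
  have "e \<in> arcs G" "f \<in> arcs G" "e' \<in> arcs G" "f' \<in> arcs G"
    using edges_betw_verts ef ef' by blast+
  note b = this[THEN digit_bounds(1)] this[THEN digit_bounds(2)]
  have "t f $ c = t f' $ c" for c
  proof -
    note ef(3)[THEN arg_cong[where f = "\<lambda>v. v $ c"]] ef'(3)[THEN arg_cong[where f = "\<lambda>v. v $ c"]]
    note eqs = this[unfolded vector_minus_component vector_add_component
        vector_scaleR_component real_scaleR_def]
    consider "D $ c = 1" | "D $ c = - 1"
      using assms(3)[of c] by blast
    then show ?thesis
    proof cases
      case 1
      show ?thesis
        using eqs[unfolded 1] b[of c] by linarith
    next
      case 2
      show ?thesis
        using eqs[unfolded 2] b[of c] by linarith
    qed
  qed
  then have "t f = t f'" by (simp add: vec_eq_iff)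
  then show ?thesis
    using ef ef' unfolding step_def by auto
qed

text \<open>The tracked offset is the difference of the two points, an integer vector between points
  of the unit cube. Allowing any integer difference rather than \<open>x = y\<close> is what makes
  the induction go through.\<close>

lemma path_of_level_approx:
  assumes "x \<in> level_approx G N t k p" "y \<in> level_approx G N t k q"
    "\<And>c. (y - x) $ c \<in> \<int>"
  shows "\<exists>P Q D. P 0 = p \<and> Q 0 = q \<and> D 0 = y - x \<and>
    (\<forall>m<k. step (P m, Q m, D m) (P (Suc m), Q (Suc m), D (Suc m))) \<and>
    (\<forall>m\<le>k. \<forall>c. D m $ c \<in> {-1, 0, 1})"
  using assms
proof (induction k arbitrary: x y p q)
  have unit: "(y - x) $ c \<in> {-1, 0, 1}"
    if xy: "x \<in> level_approx G N t k p" "y \<in> level_approx G N t k q" "(y - x) $ c \<in> \<int>"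
    for x y k p q c
  proof -
    obtain z where z: "(y - x) $ c = of_int z"
      using xy(3) by (auto elim: Ints_cases)
    have "\<bar>(y - x) $ c\<bar> \<le> 1"
      using level_approx_unit_cube[OF xy(1), of c] level_approx_unit_cube[OF xy(2), of c] by auto
    then have "\<bar>z\<bar> \<le> 1" unfolding z by linarith
    then have "z \<in> {-1, 0, 1}" by auto
    then show ?thesis unfolding z by auto
  qed
  {
    case 0
    show ?case
      using unit[OF 0(1,2,3)]
      by (intro exI[of _ "\<lambda>_. p"] exI[of _ "\<lambda>_. q"] exI[of _ "\<lambda>_. y - x"]) simp
  next
    case (Suc k)
    obtain p' e x' where x': "e \<in> edges_betw G p p'" "x' \<in> level_approx G N t k p'"
        "x = contr N t e x'"
      using Suc.prems(1) by auto
    obtain q' f y' where y': "f \<in> edges_betw G q q'" "y' \<in> level_approx G N t k q'"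
        "y = contr N t f y'"
      using Suc.prems(2) by auto
    have D': "y' - x' = real N *\<^sub>R (y - x) + t e - t f"
      using N_gt_1 by (simp add: x'(3) y'(3) contr_def algebra_simps)
    have "(y' - x') $ c \<in> \<int>" for c
    proof -
      have "(y' - x') $ c = real N * (y - x) $ c + t e $ c - t f $ c"
        unfolding D' by simp
      also have "\<dots> \<in> \<int>"
        using Suc.prems(3)[of c] edges_betw_verts[OF x'(1)] edges_betw_verts[OF y'(1)]
        by (intro Ints_diff Ints_add Ints_mult digit_Ints Ints_of_nat) auto
      finally show ?thesis .
    qed
    from Suc.IH[OF x'(2) y'(2) this] obtain P Q D where PQD: "P 0 = p'" "Q 0 = q'" "D 0 = y' - x'"
        "\<forall>m<k. step (P m, Q m, D m) (P (Suc m), Q (Suc m), D (Suc m))"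
        "\<forall>m\<le>k. \<forall>c. D m $ c \<in> {-1, 0, 1}"
      by (elim exE conjE) (rule that)
    have "step (p, q, y - x) (P 0, Q 0, D 0)"
      using x'(1) y'(1) D' unfolding step_def PQD(1-3) by blast
    \<comment> \<open>\<open>case_nat\<close> prepends the new initial state and shifts the
      remaining walk by one index.\<close>
    then have "\<forall>m<Suc k. step (case_nat p P m, case_nat q Q m, case_nat (y - x) D m)
        (case_nat p P (Suc m), case_nat q Q (Suc m), case_nat (y - x) D (Suc m))"
      using PQD(4) by (simp add: All_less_Suc2)
    moreover have "\<forall>m\<le>Suc k. \<forall>c. case_nat (y - x) D m $ c \<in> {-1, 0, 1}"
    proof (intro allI impI)
      fix m c assume "m \<le> Suc k"
      then show "case_nat (y - x) D m $ c \<in> {-1, 0, 1}"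
        using PQD(5) unit[OF Suc.prems] by (cases m) (simp_all only: nat.case Suc_le_mono)
    qed
    ultimately show ?case
      by (intro exI[of _ "case_nat p P"] exI[of _ "case_nat q Q"] exI[of _ "case_nat (y - x) D"])
        simp
  }
qed

end

section \<open>Counting the states of a walk without common points\<close>

locale disjoint_path = attractor_system G n N t K
  for G :: "(nat, 'e) pre_digraph" and n N :: nat and t :: "'e \<Rightarrow> real ^ 'd"
    and K :: "nat \<Rightarrow> (real ^ 'd) set" +
  fixes P Q :: "nat \<Rightarrow> nat" and D :: "nat \<Rightarrow> real ^ 'd" and k :: nat
  assumes path: "m < k \<Longrightarrow> step (P m, Q m, D m) (P (Suc m), Q (Suc m), D (Suc m))"
    and offset: "m \<le> k \<Longrightarrow> D m $ c \<in> {-1, 0, 1}"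
    and start: "\<not> meets (P 0, Q 0, D 0)"
    and end_verts: "P k \<in> verts G" "Q k \<in> verts G"
begin

lemma not_meets: "m \<le> k \<Longrightarrow> \<not> meets (P m, Q m, D m)"
proof (induction m)
  case (Suc m)
  then show ?case using meets_step[OF path[of m]] by auto
qed (use start in simp)

lemma path_verts: "m \<le> k \<Longrightarrow> P m \<in> verts G \<and> Q m \<in> verts G"
  using path[of m] step_verts end_verts by (cases "m = k") auto

lemma offset_mono: "a \<le> b \<Longrightarrow> b \<le> k \<Longrightarrow> D a $ c \<noteq> 0 \<Longrightarrow> D b $ c = D a $ c"
proof (induction b rule: dec_induct)
  case (step b)
  then show ?case
    using step_offset_persistent[OF path[of b], of c] offset[of b c] offset[of "Suc b" c] by simp
qed simp

definition weight :: "nat \<Rightarrow> nat" where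
  "weight m = card {c. D m $ c \<noteq> 0}"

text \<open>Supports only grow along the walk, so equal cardinality makes them equal, and the
  nonzero entries are frozen.\<close>

lemma offset_eq:
  assumes "a \<le> b" "b \<le> k" "weight a = weight b"
  shows "D a = D b"
proof -
  have "{c. D a $ c \<noteq> 0} \<subseteq> {c. D b $ c \<noteq> 0}"
    using offset_mono[OF assms(1,2)] by auto
  then have "{c. D a $ c \<noteq> 0} = {c. D b $ c \<noteq> 0}"
    using assms(3) unfolding weight_def by (intro card_subset_eq) auto
  then show ?thesis
    using offset_mono[OF assms(1,2)] by (metis (mono_tags, lifting) mem_Collect_eq vec_eq_iff)
qed

text \<open>A repeated state closes the segment between its two visits into a finite cycle, to which
  \<open>meets_coinduct\<close> applies.\<close>

lemma no_repeat:
  assumes "a < b" "b \<le> k" "D a = D b"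
  shows "(P a, Q a) \<noteq> (P b, Q b)"
proof
  assume eq: "(P a, Q a) = (P b, Q b)"
  let ?s = "\<lambda>m. (P m, Q m, D m)"
  have "meets (?s a)"
  proof (rule meets_coinduct[of "?s ` {a..<b}"])
    fix s assume "s \<in> ?s ` {a..<b}"
    then obtain m where m: "s = ?s m" "a \<le> m" "m < b" by auto
    then have st: "step s (?s (Suc m))" using path[of m] assms(2) by simp
    show "\<exists>s' \<in> ?s ` {a..<b}. step s s'"
    proof (cases "Suc m = b")
      case True
      then have "?s (Suc m) = ?s a" using eq assms(3) by simp
      then show ?thesis using st assms(1) by force
    next
      case False
      then show ?thesis using st m by force
    qed
  qed (use assms in auto)
  then show False using not_meets[of a] assms by simp
qed

text \<open>By \<open>step_swap\<close> the mirrored segment is again a walk. Zero offset at both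
  ends lets the segment and its mirror image join into a single cycle.\<close>

lemma no_swapped_repeat:
  assumes "a < b" "b \<le> k" "D a = 0" "D b = 0"
  shows "(P a, Q a) \<noteq> (Q b, P b)"
proof
  assume eq: "(P a, Q a) = (Q b, P b)"
  let ?s = "\<lambda>m. (P m, Q m, D m)" and ?r = "\<lambda>m. (Q m, P m, - D m)"
  let ?S = "?s ` {a..<b} \<union> ?r ` {a..<b}"
  have "meets (?s a)"
  proof (rule meets_coinduct[of ?S])
    have closed: "?s (Suc m) \<in> ?S \<and> ?r (Suc m) \<in> ?S" if "a \<le> m" "m < b" for m
    proof (cases "Suc m = b")
      case True
      \<comment> \<open>At the last index each of the two segments crosses over to the start of the
        other.\<close>
      then have "?s (Suc m) = ?r a" "?r (Suc m) = ?s a" using eq assms(3,4) by auto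
      then show ?thesis using assms(1) by force
    next
      case False
      then show ?thesis using that by force
    qed
    fix s assume "s \<in> ?S"
    then obtain m where m: "s = ?s m \<or> s = ?r m" "a \<le> m" "m < b"
      by (elim UnE imageE) (simp_all only: atLeastLessThan_iff, metis+)
    then have "step (?s m) (?s (Suc m))" "step (?r m) (?r (Suc m))"
      using path[of m] assms(2) step_swap by auto
    then show "\<exists>s' \<in> ?S. step s s'" using m(1) closed[OF m(2,3)] by blast
  qed (use assms in auto)
  then show False using not_meets[of a] assms by simp
qed

definition phase :: "nat \<Rightarrow> nat set" where
  "phase r = {m. m \<le> k \<and> weight m = r}"

lemma finite_phase: "finite (phase r)"
  unfolding phase_def by (rule finite_subset[of _ "{..k}"]) auto

lemma card_phase_zero: "card (phase 0) \<le> n choose 2"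
proof -
  have D0: "D m = 0 \<and> m \<le> k" if "m \<in> phase 0" for m
    using that unfolding phase_def weight_def by (simp add: vec_eq_iff)
  have ne: "{P a, Q a} \<noteq> {P b, Q b}" if "a \<in> phase 0" "b \<in> phase 0" "a < b" for a b
    using no_repeat[of a b] no_swapped_repeat[of a b] D0 that by (auto simp: doubleton_eq_iff)
  have "inj_on (\<lambda>m. {P m, Q m}) (phase 0)"
  proof (rule inj_onI)
    fix a b assume "a \<in> phase 0" "b \<in> phase 0" "{P a, Q a} = {P b, Q b}"
    then show "a = b" using ne[of a b] ne[of b a] by (metis linorder_cases)
  qed
  moreover have "(\<lambda>m. {P m, Q m}) ` phase 0 \<subseteq> {A. A \<subseteq> verts G \<and> card A = 2}"
  proof
    fix A assume "A \<in> (\<lambda>m. {P m, Q m}) ` phase 0"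
    then obtain m where m: "A = {P m, Q m}" "m \<le> k" "D m = 0" using D0 by auto
    then have "P m \<noteq> Q m"
      using not_meets[of m] meets_diagonal path_verts[of m] by metis
    then show "A \<in> {A. A \<subseteq> verts G \<and> card A = 2}"
      using path_verts[of m] m by simp
  qed
  ultimately have "card (phase 0) \<le> card {A. A \<subseteq> verts G \<and> card A = 2}"
    by (rule card_inj_on_le) simp
  also have "\<dots> = n choose 2"
    using n_subsets[of "verts G" 2] verts_eq by simp
  finally show ?thesis .
qed

lemma card_phase: "card (phase r) \<le> n\<^sup>2"
proof -
  have ne: "(P a, Q a) \<noteq> (P b, Q b)" if "a \<in> phase r" "b \<in> phase r" "a < b" for a b
    using no_repeat[of a b] offset_eq[of a b] that unfolding phase_def by simp
  have "inj_on (\<lambda>m. (P m, Q m)) (phase r)"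
  proof (rule inj_onI)
    fix a b assume "a \<in> phase r" "b \<in> phase r" "(P a, Q a) = (P b, Q b)"
    then show "a = b" using ne[of a b] ne[of b a] by (metis linorder_cases)
  qed
  moreover have "(\<lambda>m. (P m, Q m)) ` phase r \<subseteq> verts G \<times> verts G"
    using path_verts unfolding phase_def by auto
  ultimately have "card (phase r) \<le> card (verts G \<times> verts G)"
    by (rule card_inj_on_le) simp
  then show ?thesis
    using verts_eq by (simp add: card_cartesian_product power2_eq_square)
qed

text \<open>Pigeonhole applied to \<open>P\<close> and \<open>Q\<close> separately yields two loops,
  possibly with different start times and lengths; \<open>step_exchange\<close> allows them to be
  run side by side.\<close>

lemma card_phase_full: "card (phase CARD('d)) \<le> n"
proof (rule ccontr)
  let ?F = "phase CARD('d)"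
  assume "\<not> card ?F \<le> n"
  then have big: "card ?F > card (verts G)" using verts_eq by simp
  have repeat: "\<exists>a b. a \<in> ?F \<and> b \<in> ?F \<and> a < b \<and> R a = R b"
    if "R ` ?F \<subseteq> verts G" for R :: "nat \<Rightarrow> nat"
  proof -
    have "\<not> inj_on R ?F"
      using card_inj_on_le[OF _ that] big by auto
    then show ?thesis unfolding inj_on_def by (metis linorder_neqE_nat)
  qed
  have "P ` ?F \<subseteq> verts G" "Q ` ?F \<subseteq> verts G"
    using path_verts unfolding phase_def by auto
  then obtain a b u v where ab: "a \<in> ?F" "b \<in> ?F" "a < b" "P a = P b"
      and uv: "u \<in> ?F" "v \<in> ?F" "u < v" "Q u = Q v"
    using repeat[of P] repeat[of Q] by blast
  \<comment> \<open>A common start for both walks: each runs from \<open>s\<close> to its own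
    repetition and then jumps back to \<open>a\<close> or \<open>u\<close>, which is not before
    \<open>s\<close>.\<close>
  define s where "s = min a u"
  have sF: "s \<in> ?F" unfolding s_def using ab uv by (simp add: min_def)
  then have "{c. D s $ c \<noteq> 0} = UNIV"
    unfolding phase_def weight_def by (intro card_subset_eq) auto
  then have nz: "D s $ c \<noteq> 0" for c by auto
  then have sign: "D s $ c \<in> {-1, 1}" for c
    using offset[of s c] sF unfolding phase_def by auto
  have const: "D m = D s" if "s \<le> m" "m \<le> k" for m
    using offset_mono[OF that nz] by (simp add: vec_eq_iff)
  have bk: "b \<le> k" "v \<le> k" using ab uv unfolding phase_def by auto
  have st: "step (P m, Q m, D s) (P (Suc m), Q (Suc m), D s)" if "s \<le> m" "m < k" for m
    using path[OF that(2)] const[of m] const[of "Suc m"] that by simp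
  \<comment> \<open>A full product of vertex sets: the two time indices are decoupled, so no common
    period has to be found.\<close>
  let ?S = "(\<lambda>(x, y). (x, y, D s)) ` (P ` {s..<b} \<times> Q ` {s..<v})"
  have "meets (P s, Q s, D s)"
  proof (rule meets_coinduct[of ?S])
    fix z assume "z \<in> ?S"
    then obtain l m where lm: "z = (P l, Q m, D s)" "s \<le> l" "l < b" "s \<le> m" "m < v" by auto
    then have "step z (P (Suc l), Q (Suc m), D s)"
      using step_exchange[OF st[of l] st[of m] sign] bk by simp
    moreover have "P (Suc l) \<in> P ` {s..<b}"
    proof (cases "Suc l = b")
      case True
      then show ?thesis using ab by (auto simp: s_def intro!: rev_image_eqI[of a])
    next
      case False
      then show ?thesis using lm by simp
    qed
    moreover have "Q (Suc m) \<in> Q ` {s..<v}"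
    proof (cases "Suc m = v")
      case True
      then show ?thesis using uv by (auto simp: s_def intro!: rev_image_eqI[of u])
    next
      case False
      then show ?thesis using lm by simp
    qed
    ultimately show "\<exists>z' \<in> ?S. step z z'" by force
  next
    have "s < b" "s < v" using ab uv unfolding s_def by auto
    then show "(P s, Q s, D s) \<in> ?S" by force
  qed simp
  then show False using not_meets[of s] sF unfolding phase_def by simp
qed

lemma length_less_c_bound: "k < c_bound n CARD('d)"
proof -
  let ?d = "CARD('d)"
  \<comment> \<open>Positivity separates phase 0 from the full-support phase when the sum is split
    below.\<close>
  have d: "?d \<ge> 1" using zero_less_card_finite[where 'a='d] by linarith
  have "weight m \<le> ?d" for m
    unfolding weight_def by (intro card_mono) auto
  then have "{..k} \<subseteq> (\<Union>r \<in> {..?d}. phase r)"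
    unfolding phase_def by auto
  then have "card {..k} \<le> card (\<Union>r \<in> {..?d}. phase r)"
    using finite_phase by (intro card_mono) auto
  also have "\<dots> \<le> (\<Sum>r \<in> {..?d}. card (phase r))"
    by (rule card_UN_le) simp
  also have "{..?d} = insert 0 (insert ?d {1..<?d})"
    using d by auto
  also have "(\<Sum>r \<in> insert 0 (insert ?d {1..<?d}). card (phase r)) =
      card (phase 0) + (card (phase ?d) + (\<Sum>r \<in> {1..<?d}. card (phase r)))"
    using d by (subst sum.insert; simp)+
  also have "\<dots> \<le> (n choose 2) + (n + (\<Sum>r \<in> {1..<?d}. n\<^sup>2))"
    by (intro add_mono sum_mono card_phase_zero card_phase_full card_phase)
  also have "\<dots> = (?d - 1) * n\<^sup>2 + ((n choose 2) + n)" by simp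
  also have "(n choose 2) + n = (n\<^sup>2 + n) div 2"
  proof -
    have "(n\<^sup>2 + n) = n * (n - 1) + 2 * n"
      by (cases n) (auto simp: power2_eq_square)
    then show ?thesis by (simp add: choose_two)
  qed
  \<comment> \<open>The walk has \<open>k + 1\<close> states, whence the strict inequality.\<close>
  finally show ?thesis using d unfolding c_bound_def card_atMost by linarith
qed

end

section \<open>From a common point of the approximations to one of the attractors\<close>

theorem theorem1p6:
  fixes G :: "(nat, 'e) pre_digraph" and n N :: nat and t :: "'e \<Rightarrow> real ^ 'd"
    and K :: "nat \<Rightarrow> (real ^ 'd) set" and i j :: nat
  assumes "cantor_graph_system G n N t"
    and "is_attractor G N t K"
    and "i \<in> {1..n}" and "j \<in> {1..n}" and "i \<noteq> j"
  shows "K i \<inter> K j \<noteq> {} \<longleftrightarrow>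
    level_approx G N t (c_bound n CARD('d)) i \<inter> level_approx G N t (c_bound n CARD('d)) j \<noteq> {}"
proof -
  interpret attractor_system G n N t K
    using assms(1,2) by (simp add: attractor_system_def attractor_system_axioms_def)
  have v: "i \<in> verts G" "j \<in> verts G" using assms(3,4) verts_eq by auto
  let ?k = "c_bound n CARD('d)"
  show ?thesis
  proof
    assume "K i \<inter> K j \<noteq> {}"
    then show "level_approx G N t ?k i \<inter> level_approx G N t ?k j \<noteq> {}"
      using K_subset_level_approx v by blast
  next
    assume "level_approx G N t ?k i \<inter> level_approx G N t ?k j \<noteq> {}"
    then obtain x where x: "x \<in> level_approx G N t ?k i" "x \<in> level_approx G N t ?k j" by auto
    have "(x - x) $ c \<in> \<int>" for c by simp
    from path_of_level_approx[OF x this] obtain P Q D where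
      PQD: "P 0 = i" "Q 0 = j" "D 0 = 0"
        "\<And>m. m < ?k \<Longrightarrow> step (P m, Q m, D m) (P (Suc m), Q (Suc m), D (Suc m))"
        "\<And>m c. m \<le> ?k \<Longrightarrow> D m $ c \<in> {-1, 0, 1}"
      by auto
    have "meets (i, j, 0)"
    proof (rule ccontr)
      assume nm: "\<not> meets (i, j, 0)"
      have "P ?k \<in> verts G \<and> Q ?k \<in> verts G"
      proof (cases "?k")
        case 0
        then show ?thesis using PQD(1,2) v by simp
      next
        case (Suc m)
        then show ?thesis
          using PQD(4)[of m] edges_betw_verts unfolding step_def by auto
      qed
      \<comment> \<open>With walk length \<open>c_bound\<close> itself, the strict length bound
        contradicts irreflexivity.\<close>
      then interpret disjoint_path G n N t K P Q D ?k
        using PQD nm by unfold_locales auto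
      show False using length_less_c_bound by simp
    qed
    then show "K i \<inter> K j \<noteq> {}" unfolding meets_def by auto
  qed
qed

end
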